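(* Let $n$ and $s$ be positive integers with $s\le n$. Let $G_1$ be any graph, let $G_1^v$ be the graph obtained from $G_1$ by adding a new vertex $v$ adjacent to all the vertices of $G_1$, and let $N$ be an integer such that $N\ge r(G_1^v,K_n)$. If $\left\lceil\frac{(s+1)(N-n)}{n}\right\rceil\ge r(G_1,K_{n+1}-K_{1,s})$, then $r(G_1^v,K_{n+1}-K_{1,s})\le N$.
   Context: Graphs are finite and simple. For graphs $G$ and $H$, $r(G,H)$ is the smallest integer $N$ such that for every $n\ge N$ and every coloring of the edges of the complete graph $K_n$ with red and blue there is either a red copy of $G$ or a blue copy of $H$ (copies are subgraphs, not necessarily induced). For $s\le n-1$, $K_n-K_{1,s}$ is the graph obtained from the complete graph $K_n$ on $n$ vertices by deleting the edges of a star $K_{1,s}$, i.e. deleting $s$ edges all incident to one common vertex. *)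

theory Defs
  imports Complex_Main "Graph_Theory.Graph_Theory"
begin

text \<open>
  Finite simple graphs are the locale \<open>pair_graph\<close>: an edge \<open>uv\<close> is represented by both arcs
  \<open>(u, v)\<close> and \<open>(v, u)\<close>. The graph with no vertices is allowed.
\<close>

definition complete_graph :: "nat \<Rightarrow> nat pair_pre_digraph" where
  "complete_graph n = \<lparr> pverts = {..<n}, parcs = {(u, v). u < n \<and> v < n \<and> u \<noteq> v} \<rparr>"

text \<open>
  The graph \<open>K\<^sub>n - K\<^sub>1\<^sub>,\<^sub>s\<close>, meaningful for \<open>s < n\<close>; the deleted star has centre \<open>0\<close> and
  leaves \<open>1, \<dots>, s\<close>.
\<close>

definition complete_minus_star :: "nat \<Rightarrow> nat \<Rightarrow> nat pair_pre_digraph" where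
  "complete_minus_star n s =
    \<lparr> pverts = pverts (complete_graph n),
      parcs = parcs (complete_graph n) - ({0} \<times> {1..s} \<union> {1..s} \<times> {0}) \<rparr>"

text \<open>The new vertex is \<open>None\<close>; the old vertices are renamed by \<open>Some\<close>.\<close>

definition add_universal_vertex :: "'a pair_pre_digraph \<Rightarrow> 'a option pair_pre_digraph" where
  "add_universal_vertex G =
    \<lparr> pverts = insert None (Some ` pverts G),
      parcs = map_prod Some Some ` parcs G
        \<union> {None} \<times> Some ` pverts G \<union> Some ` pverts G \<times> {None} \<rparr>"

definition contains_copy :: "'b pair_pre_digraph \<Rightarrow> 'a pair_pre_digraph \<Rightarrow> bool" where
  "contains_copy H G \<longleftrightarrow> (\<exists>C. subgraph C (with_proj H) \<and> digraph_iso (with_proj G) C)"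

datatype colour = Red | Blue

text \<open>
  A colouring of the edges of \<open>K\<^sub>n\<close> is a function on vertex sets, of which only the values on
  the two-element subsets of \<open>{..<n}\<close> matter.
\<close>

definition colour_class :: "nat \<Rightarrow> (nat set \<Rightarrow> colour) \<Rightarrow> colour \<Rightarrow> nat pair_pre_digraph" where
  "colour_class n c k =
    \<lparr> pverts = pverts (complete_graph n),
      parcs = {(u, v) \<in> parcs (complete_graph n). c {u, v} = k} \<rparr>"

text \<open>For finite simple graphs the minimum exists, by Ramsey's theorem.\<close>

definition ramsey_number :: "'a pair_pre_digraph \<Rightarrow> 'b pair_pre_digraph \<Rightarrow> nat" where
  "ramsey_number G H = (LEAST N. \<forall>n\<ge>N. \<forall>c.
     contains_copy (colour_class n c Red) G \<or> contains_copy (colour_class n c Blue) H)"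

lemma complete_digraph_complete_graph: "complete_digraph n (with_proj (complete_graph n))"
  unfolding complete_digraph_pair_def by (auto simp: complete_graph_def)

lemma pair_graphI:
  assumes "finite (pverts G)" "parcs G \<subseteq> pverts G \<times> pverts G"
    and "\<And>u v. (u, v) \<in> parcs G \<Longrightarrow> (v, u) \<in> parcs G" "\<And>u. (u, u) \<notin> parcs G"
  shows "pair_graph G"
proof -
  have "finite (parcs G)"
    using assms(1,2) by (meson finite_SigmaI finite_subset)
  then show ?thesis
    using assms by unfold_locales (auto simp: symmetric_def intro!: symI)
qed

lemma pair_graph_complete_graph: "pair_graph (complete_graph n)"
  by (rule pair_graphI) (auto simp: complete_graph_def)

lemma pair_graph_complete_minus_star: "pair_graph (complete_minus_star n s)"
  by (rule pair_graphI) (auto simp: complete_minus_star_def complete_graph_def)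

lemma pair_graph_colour_class: "pair_graph (colour_class n c k)"
  by (rule pair_graphI) (auto simp: colour_class_def complete_graph_def insert_commute)

lemma pair_graph_add_universal_vertex:
  assumes "pair_graph G"
  shows "pair_graph (add_universal_vertex G)"
proof -
  interpret pair_graph G by fact
  have "(Some u, Some v) \<in> map_prod Some Some ` parcs G \<longleftrightarrow> (u, v) \<in> parcs G" for u v
    by force
  then show ?thesis
    by (intro pair_graphI)
      (auto simp: add_universal_vertex_def pair_finite_verts
        dest: arcs_symmetric arc_fst_in_verts arc_snd_in_verts no_loops)
qed

lemma contains_copy_iff:
  assumes "pair_wf_digraph G" "pair_wf_digraph H"
  shows "contains_copy H G \<longleftrightarrow>
    (\<exists>f. inj_on f (pverts G) \<and> f ` pverts G \<subseteq> pverts H \<and> map_prod f f ` parcs G \<subseteq> parcs H)"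
proof
  assume "contains_copy H G"
  then obtain C h where C: "subgraph C (with_proj H)" "C = app_iso h (with_proj G)"
    and h: "pre_digraph.digraph_isomorphism (with_proj G) h"
    unfolding contains_copy_def digraph_iso_def by blast
  from C have compat: "iso_tail h = fst" "iso_head h = snd"
    and sub: "iso_verts h ` pverts G \<subseteq> pverts H" "iso_arcs h ` parcs G \<subseteq> parcs H"
    by (auto simp: subgraph_def compatible_def)
  have inj: "inj_on (iso_verts h) (pverts G)"
    and arcs: "\<And>a. a \<in> parcs G \<Longrightarrow> iso_arcs h a = map_prod (iso_verts h) (iso_verts h) a"
    using h by (auto simp: pre_digraph.digraph_isomorphism_def compat prod_eq_iff)
  have "map_prod (iso_verts h) (iso_verts h) ` parcs G \<subseteq> parcs H"
    using sub(2) arcs by (metis image_cong)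
  with inj sub(1) show "\<exists>f. inj_on f (pverts G) \<and> f ` pverts G \<subseteq> pverts H
      \<and> map_prod f f ` parcs G \<subseteq> parcs H"
    by blast
next
  assume "\<exists>f. inj_on f (pverts G) \<and> f ` pverts G \<subseteq> pverts H \<and> map_prod f f ` parcs G \<subseteq> parcs H"
  then obtain f where f: "inj_on f (pverts G)" "f ` pverts G \<subseteq> pverts H"
    "map_prod f f ` parcs G \<subseteq> parcs H"
    by blast
  interpret G: pair_wf_digraph G by fact
  interpret H: pair_wf_digraph H by fact
  define h where "h = \<lparr> iso_verts = f, iso_arcs = map_prod f f,
    iso_head = snd, iso_tail = fst \<rparr>"
  have "parcs G \<subseteq> pverts G \<times> pverts G"
    using G.arc_fst_in_verts G.arc_snd_in_verts by fastforce
  then have "inj_on (map_prod f f) (parcs G)"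
    using map_prod_inj_on[OF f(1) f(1)] by (rule inj_on_subset[rotated])
  then have iso: "pre_digraph.digraph_isomorphism (with_proj G) h"
    using f(1) G.wf_digraph by (auto simp: pre_digraph.digraph_isomorphism_def h_def)
  have "wf_digraph (app_iso h (with_proj G))"
    using G.wf_digraphI_app_iso iso by blast
  then have "subgraph (app_iso h (with_proj G)) (with_proj H)"
    using f(2,3) H.wf_digraph by (auto simp: subgraph_def compatible_def h_def)
  with iso show "contains_copy H G"
    unfolding contains_copy_def digraph_iso_def by blast
qed

end

theory Submission
  imports Defs "HOL-Library.Ramsey"
begin

text \<open>
  In a colouring of \<open>K\<^sub>m\<close>, \<open>m \<ge> N\<close>, without a red \<open>G\<^sub>1\<^sup>v\<close> there is a blue \<open>K\<^sub>n\<close>, on a vertex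
  set \<open>A\<close>. If some vertex outside \<open>A\<close> has at least \<open>n - s\<close> blue neighbours in \<open>A\<close>, it forms a
  blue \<open>K\<^sub>n\<^sub>+\<^sub>1 - K\<^sub>1\<^sub>,\<^sub>s\<close> together with \<open>A\<close>. Otherwise each of the \<open>m - n\<close> vertices outside \<open>A\<close>
  sends at least \<open>s + 1\<close> red edges to \<open>A\<close>, so some \<open>a \<in> A\<close> has at least \<open>(s + 1) (m - n) / n\<close>
  red neighbours. Among them there is a red \<open>G\<^sub>1\<close>, to which \<open>a\<close> can be added, or a blue
  \<open>K\<^sub>n\<^sub>+\<^sub>1 - K\<^sub>1\<^sub>,\<^sub>s\<close>.
\<close>

section \<open>Monochromatic copies inside a vertex set\<close>

text \<open>The vertex set \<open>V\<close> is arbitrary, so that the red neighbourhood of a vertex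
  can be searched without renumbering it.\<close>

definition coloured_copy ::
    "'b set \<Rightarrow> ('b set \<Rightarrow> colour) \<Rightarrow> colour \<Rightarrow> 'a pair_pre_digraph \<Rightarrow> bool" where
  "coloured_copy V c k G \<longleftrightarrow> (\<exists>f. inj_on f (pverts G) \<and> f ` pverts G \<subseteq> V
     \<and> (\<forall>(u, v) \<in> parcs G. c {f u, f v} = k))"

lemma not_Red: "k \<noteq> Red \<longleftrightarrow> k = Blue"
  by (cases k) auto

lemma coloured_copyI:
  assumes "inj_on f (pverts G)" "f ` pverts G \<subseteq> V"
    and "\<And>u v. (u, v) \<in> parcs G \<Longrightarrow> c {f u, f v} = k"
  shows "coloured_copy V c k G"
  unfolding coloured_copy_def by (intro exI[of _ f]) (use assms in auto)

lemma coloured_copyE: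
  assumes "coloured_copy V c k G"
  obtains f where "inj_on f (pverts G)" "f ` pverts G \<subseteq> V"
    "\<And>u v. (u, v) \<in> parcs G \<Longrightarrow> c {f u, f v} = k"
proof -
  from assms obtain f where "inj_on f (pverts G)" "f ` pverts G \<subseteq> V"
    "\<forall>(u, v) \<in> parcs G. c {f u, f v} = k"
    unfolding coloured_copy_def by (elim exE conjE)
  then show thesis
    by (intro that[of f]) auto
qed

lemma coloured_copy_mono:
  assumes "coloured_copy U c k G" "U \<subseteq> V"
  shows "coloured_copy V c k G"
  using assms unfolding coloured_copy_def by (meson order_trans)

text \<open>Only the colour condition on arcs remains: an injective \<open>f\<close> into
  \<open>{..<m}\<close> sends the ends of an arc to distinct vertices below \<open>m\<close>, since
  \<open>G\<close> has no loops.\<close>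

lemma contains_copy_colour_class_iff:
  assumes "pair_graph G"
  shows "contains_copy (colour_class m c k) G \<longleftrightarrow> coloured_copy {..<m} c k G"
proof -
  interpret G: pair_graph G by fact
  interpret C: pair_graph "colour_class m c k" by (rule pair_graph_colour_class)
  have "map_prod f f ` parcs G \<subseteq> parcs (colour_class m c k)
      \<longleftrightarrow> (\<forall>(u, v) \<in> parcs G. c {f u, f v} = k)"
    if f: "inj_on f (pverts G)" "f ` pverts G \<subseteq> {..<m}" for f
  proof -
    have "f u < m \<and> f v < m \<and> f u \<noteq> f v" if "(u, v) \<in> parcs G" for u v
      using f G.wellformed'[OF that] G.no_loops'[OF that] by (auto dest: inj_onD)
    then show ?thesis
      by (fastforce simp: colour_class_def complete_graph_def)
  qed
  moreover have "pverts (colour_class m c k) = {..<m}"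
    by (simp add: colour_class_def complete_graph_def)
  ultimately show ?thesis
    unfolding contains_copy_iff[OF G.pair_wf_digraph C.pair_wf_digraph] coloured_copy_def
    by auto
qed

section \<open>Ramsey numbers on arbitrary finite vertex sets\<close>

text \<open>Any injection of the vertices into \<open>R\<close> will do, because adjacent vertices
  of \<open>G\<close> are distinct.\<close>

lemma coloured_copy_clique:
  assumes "pair_graph G" "finite R" "card (pverts G) \<le> card R"
    and "\<And>u v. u \<in> R \<Longrightarrow> v \<in> R \<Longrightarrow> u \<noteq> v \<Longrightarrow> c {u, v} = k"
  shows "coloured_copy R c k G"
proof -
  interpret pair_graph G by fact
  obtain f where f: "f ` pverts G \<subseteq> R" "inj_on f (pverts G)"
    using card_le_inj[OF pair_finite_verts assms(2,3)] by blast
  show ?thesis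
  proof (rule coloured_copyI[OF f(2,1)])
    fix u v assume "(u, v) \<in> parcs G"
    then have "u \<in> pverts G" "v \<in> pverts G" "u \<noteq> v"
      using wellformed' no_loops' by auto
    then show "c {f u, f v} = k"
      using f by (intro assms(4)) (auto dest: inj_onD)
  qed
qed

text \<open>A \<open>LEAST\<close> has its defining property only if some number has it. Ramsey's
  theorem, for cliques of the orders of \<open>G\<close> and \<open>H\<close>, supplies one.\<close>

lemma ramsey_number_coloured_copy_lessThan:
  fixes c :: "nat set \<Rightarrow> colour"
  assumes G: "pair_graph G" and H: "pair_graph H" and "ramsey_number G H \<le> m"
  shows "coloured_copy {..<m} c Red G \<or> coloured_copy {..<m} c Blue H"
proof -
  let ?P = "\<lambda>N. \<forall>n\<ge>N. \<forall>c. contains_copy (colour_class n c Red) G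
    \<or> contains_copy (colour_class n c Blue) H"
  obtain r where r: "\<And>(V::nat set) E. finite V \<Longrightarrow> r \<le> card V \<Longrightarrow>
      \<exists>R \<subseteq> V. card R = card (pverts G) \<and> clique R E \<or> card R = card (pverts H) \<and> indep R E"
    using ramsey2 by metis
  have "?P r"
  proof (intro allI impI)
    fix n c assume "r \<le> n"
    \<comment> \<open>The red edges serve as the edge set, so an independent set is a blue
      clique.\<close>
    then obtain R where R: "R \<subseteq> {..<n}"
      and *: "card R = card (pverts G) \<and> clique R {e. c e = Red}
        \<or> card R = card (pverts H) \<and> indep R {e. c e = Red}"
      using r[of "{..<n}" "{e. c e = Red}"] by auto
    have fin: "finite R"
      using R finite_subset by blast
    have "coloured_copy R c Red G \<or> coloured_copy R c Blue H"
      using *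
    proof
      assume "card R = card (pverts G) \<and> clique R {e. c e = Red}"
      then show ?thesis
        using coloured_copy_clique[OF G fin, of c Red] by (auto simp: clique_def)
    next
      assume "card R = card (pverts H) \<and> indep R {e. c e = Red}"
      then show ?thesis
        using coloured_copy_clique[OF H fin, of c Blue] by (auto simp: indep_def not_Red)
    qed
    then show "contains_copy (colour_class n c Red) G \<or> contains_copy (colour_class n c Blue) H"
      unfolding contains_copy_colour_class_iff[OF G] contains_copy_colour_class_iff[OF H]
      using R coloured_copy_mono[of R c Red G] coloured_copy_mono[of R c Blue H] by blast
  qed
  then have "?P (ramsey_number G H)"
    unfolding ramsey_number_def by (rule LeastI)
  then show ?thesis
    using assms(3) contains_copy_colour_class_iff[OF G] contains_copy_colour_class_iff[OF H]
    by blast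
qed

lemma coloured_copy_image:
  assumes "coloured_copy U (\<lambda>e. c (g ` e)) k G" "inj_on g U"
  shows "coloured_copy (g ` U) c k G"
proof -
  from assms(1) obtain f where f: "inj_on f (pverts G)" "f ` pverts G \<subseteq> U"
    "\<And>u v. (u, v) \<in> parcs G \<Longrightarrow> c (g ` {f u, f v}) = k"
    by (rule coloured_copyE) blast
  show ?thesis
  proof (rule coloured_copyI)
    show "inj_on (g \<circ> f) (pverts G)"
      using f(1,2) assms(2) by (meson comp_inj_on inj_on_subset)
  qed (use f in auto)
qed

text \<open>Number the vertices of \<open>V\<close> by \<open>g\<close>, pull the colouring back to
  \<open>{..<card V}\<close>, and carry the copy found there forward again.\<close>

lemma ramsey_number_coloured_copy:
  assumes "pair_graph G" "pair_graph H" "finite V" "ramsey_number G H \<le> card V"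
  shows "coloured_copy V c Red G \<or> coloured_copy V c Blue H"
proof -
  obtain g where "bij_betw g {..<card V} V"
    using assms(3) finite_same_card_bij by (metis card_lessThan finite_lessThan)
  then have g: "inj_on g {..<card V}" "g ` {..<card V} = V"
    by (auto simp: bij_betw_def)
  show ?thesis
    using ramsey_number_coloured_copy_lessThan[OF assms(1,2,4), of "\<lambda>e. c (g ` e)"]
      coloured_copy_image[OF _ g(1), of c Red G] coloured_copy_image[OF _ g(1), of c Blue H]
    unfolding g(2) by blast
qed

lemma ramsey_number_le:
  assumes "pair_graph G" "pair_graph H"
    and "\<And>m c. N \<le> m \<Longrightarrow>
      coloured_copy {..<m::nat} c Red G \<or> coloured_copy {..<m} c Blue H"
  shows "ramsey_number G H \<le> N"
  unfolding ramsey_number_def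
  by (rule Least_le)
    (simp add: contains_copy_colour_class_iff[OF assms(1)]
      contains_copy_colour_class_iff[OF assms(2)] assms(3))

section \<open>Extending monochromatic copies by one vertex\<close>

lemma coloured_copy_complete_graphE:
  assumes "coloured_copy V c k (complete_graph n)"
  obtains A where "A \<subseteq> V" "finite A" "card A = n"
    "\<And>u v. u \<in> A \<Longrightarrow> v \<in> A \<Longrightarrow> u \<noteq> v \<Longrightarrow> c {u, v} = k"
proof -
  from assms obtain f where f: "inj_on f {..<n}" "f ` {..<n} \<subseteq> V"
    and col: "\<And>u v. u < n \<Longrightarrow> v < n \<Longrightarrow> u \<noteq> v \<Longrightarrow> c {f u, f v} = k"
    by (auto simp: complete_graph_def elim!: coloured_copyE)
  show thesis
  proof (rule that)
    show "c {u, v} = k" if "u \<in> f ` {..<n}" "v \<in> f ` {..<n}" "u \<noteq> v" for u v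
      using that col by auto
  qed (use f in \<open>auto simp: card_image\<close>)
qed

lemma coloured_copy_add_universal_vertex:
  assumes "coloured_copy U c k G" "a \<notin> U" "\<And>u. u \<in> U \<Longrightarrow> c {a, u} = k"
  shows "coloured_copy (insert a U) c k (add_universal_vertex G)"
proof -
  from assms(1) obtain f where f: "inj_on f (pverts G)" "f ` pverts G \<subseteq> U"
    "\<And>u v. (u, v) \<in> parcs G \<Longrightarrow> c {f u, f v} = k"
    by (rule coloured_copyE) blast
  show ?thesis
  proof (rule coloured_copyI)
    show "inj_on (case_option a f) (pverts (add_universal_vertex G))"
      using f(1,2) assms(2) by (auto simp: add_universal_vertex_def inj_on_def)
    show "case_option a f ` pverts (add_universal_vertex G) \<subseteq> insert a U"
      using f(2) by (auto simp: add_universal_vertex_def)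
    show "c {case_option a f u, case_option a f v} = k"
      if "(u, v) \<in> parcs (add_universal_vertex G)" for u v
      using that f(2,3) assms(3) by (auto simp: add_universal_vertex_def insert_commute[of _ a])
  qed
qed

text \<open>The star's centre \<open>0\<close> goes to \<open>x\<close>, its \<open>s\<close> leaves
  go to \<open>A - T\<close>, where the colours at \<open>x\<close> are irrelevant, and the other
  \<open>n - s\<close> vertices go to neighbours of \<open>x\<close> in colour
  \<open>k\<close>.\<close>

lemma coloured_copy_complete_minus_star:
  assumes A: "finite A" "card A = n" "\<And>u v. u \<in> A \<Longrightarrow> v \<in> A \<Longrightarrow> u \<noteq> v \<Longrightarrow> c {u, v} = k"
    and x: "x \<notin> A" "n - s \<le> card {a \<in> A. c {x, a} = k}" and "s \<le> n"
  shows "coloured_copy (insert x A) c k (complete_minus_star (n + 1) s)"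
proof -
  \<comment> \<open>Trimming to exactly \<open>n - s\<close> neighbours leaves exactly
    \<open>s\<close> vertices of \<open>A\<close> for the leaves.\<close>
  obtain T where "T \<subseteq> {a \<in> A. c {x, a} = k}" "card T = n - s"
    using obtain_subset_with_card_n[OF x(2)] by metis
  then have T: "T \<subseteq> A" "card T = n - s" "\<And>a. a \<in> T \<Longrightarrow> c {x, a} = k"
    by auto
  have fin: "finite T"
    using T(1) A(1) finite_subset by blast
  obtain g where g: "bij_betw g {s + 1..n} T"
    using finite_same_card_bij[of "{s + 1..n}" T] fin T(2) by auto
  obtain h where h: "bij_betw h {1..s} (A - T)"
    using finite_same_card_bij[of "{1..s}" "A - T"] A T(1,2) fin \<open>s \<le> n\<close>
    by (auto simp: card_Diff_subset)
  define f where "f i = (if i = 0 then x else if i \<le> s then h i else g i)" for i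
  have "bij_betw f {1..s} (A - T)"
    using h by (subst bij_betw_cong[of _ f h]) (auto simp: f_def)
  moreover have "bij_betw f {s + 1..n} T"
    using g by (subst bij_betw_cong[of _ f g]) (auto simp: f_def)
  ultimately have "bij_betw f ({1..s} \<union> {s + 1..n}) ((A - T) \<union> T)"
    by (rule bij_betw_combine) auto
  moreover have "{1..s} \<union> {s + 1..n} = {1..n}"
    using \<open>s \<le> n\<close> by auto
  ultimately have bij: "bij_betw f {1..n} A"
    using T(1) by (simp add: Un_absorb2)
  have fT: "f i \<in> T" if "s < i" "i \<le> n" for i
    using that g by (auto simp: f_def bij_betw_def)
  have fA: "f i \<in> A" if "0 < i" "i \<le> n" for i
    using that bij by (auto simp: bij_betw_def)
  have verts: "pverts (complete_minus_star (n + 1) s) = insert 0 {1..n}"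
    by (auto simp: complete_minus_star_def complete_graph_def)
  show ?thesis
  proof (rule coloured_copyI)
    show "inj_on f (pverts (complete_minus_star (n + 1) s))"
      unfolding verts using bij x(1) by (auto simp: bij_betw_def f_def[of 0])
    show "f ` pverts (complete_minus_star (n + 1) s) \<subseteq> insert x A"
      unfolding verts using bij by (auto simp: bij_betw_def f_def[of 0])
    fix u v assume "(u, v) \<in> parcs (complete_minus_star (n + 1) s)"
    then have uv: "u \<le> n" "v \<le> n" "u \<noteq> v" "u = 0 \<Longrightarrow> s < v" "v = 0 \<Longrightarrow> s < u"
      by (auto simp: complete_minus_star_def complete_graph_def)
    consider "u = 0" | "v = 0" | "0 < u" "0 < v"
      by auto
    then show "c {f u, f v} = k"
    proof cases
      case 1
      then show ?thesis using uv T(3) fT by (simp add: f_def[of 0])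
    next
      case 2
      then show ?thesis using uv T(3) fT by (simp add: f_def[of 0] insert_commute[of _ x])
    next
      case 3
      then have "f u \<noteq> f v"
        using uv bij by (auto simp: bij_betw_def dest: inj_onD)
      then show ?thesis using A(3)[OF fA fA] 3 uv by simp
    qed
  qed
qed

section \<open>Double counting and the main argument\<close>

text \<open>Count the pairs \<open>(x, a)\<close> satisfying \<open>P\<close> from both sides: some
  \<open>a\<close> has at least the average degree. Multiplying by \<open>card A\<close> avoids
  division.\<close>

lemma exists_large_degree:
  assumes "finite A" "finite X" "A \<noteq> {}"
    and "\<And>x. x \<in> X \<Longrightarrow> d \<le> card {a \<in> A. P x a}"
  shows "\<exists>a\<in>A. d * card X \<le> card A * card {x \<in> X. P x a}"
proof (rule ccontr)
  assume "\<not> ?thesis"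
  then have "(\<Sum>a\<in>A. card A * card {x \<in> X. P x a}) < (\<Sum>a\<in>A. d * card X)"
    using assms(1,3) by (intro sum_strict_mono) auto
  \<comment> \<open>The right-hand sum is \<open>card A * (d * card X)\<close>, so the positive
    factor \<open>card A\<close> cancels.\<close>
  then have "(\<Sum>a\<in>A. card {x \<in> X. P x a}) < d * card X"
    using assms(1,3) by (simp add: sum_distrib_left[symmetric] card_gt_0_iff)
  also have "\<dots> \<le> (\<Sum>x\<in>X. card {a \<in> A. P x a})"
    using sum_bounded_below[of X d "\<lambda>x. card {a \<in> A. P x a}"] assms(4) by (simp add: mult.commute)
  also have "\<dots> = (\<Sum>a\<in>A. card {x \<in> X. P x a})"
    using sum.swap_restrict[OF assms(2,1), of "\<lambda>_ _. 1::nat" P] by simp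
  finally show False by simp
qed

theorem theorem1:
  fixes n s :: nat and N :: int and G1 :: "'a pair_pre_digraph"
  assumes "1 \<le> n" and "1 \<le> s" and "s \<le> n"
    and "pair_graph G1"
    and "N \<ge> int (ramsey_number (add_universal_vertex G1) (complete_graph n))"
    and "\<lceil>(real s + 1) * (real_of_int N - real n) / real n\<rceil>
           \<ge> int (ramsey_number G1 (complete_minus_star (n + 1) s))"
  shows "int (ramsey_number (add_universal_vertex G1) (complete_minus_star (n + 1) s)) \<le> N"
proof -
  let ?Gv = "add_universal_vertex G1" and ?H = "complete_minus_star (n + 1) s"
  note graphs = \<open>pair_graph G1\<close> pair_graph_add_universal_vertex[OF \<open>pair_graph G1\<close>]
    pair_graph_complete_graph pair_graph_complete_minus_star
  \<comment> \<open>Passing to \<open>nat N\<close> loses nothing: \<open>N\<close> bounds a Ramsey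
    number from above, so it is nonnegative.\<close>
  have "coloured_copy {..<m} c Red ?Gv \<or> coloured_copy {..<m} c Blue ?H" if "nat N \<le> m" for m c
  proof (rule ccontr)
    assume "\<not> ?thesis"
    then have no_red: "\<not> coloured_copy {..<m} c Red ?Gv"
      and no_blue: "\<not> coloured_copy {..<m} c Blue ?H"
      by auto
    have "ramsey_number ?Gv (complete_graph n) \<le> m"
      using that assms(5) by linarith
    then have "coloured_copy {..<m} c Blue (complete_graph n)"
      using ramsey_number_coloured_copy_lessThan[OF graphs(2,3)] no_red by blast
    then obtain A where A: "A \<subseteq> {..<m}" "finite A" "card A = n"
      and blue: "\<And>u v. u \<in> A \<Longrightarrow> v \<in> A \<Longrightarrow> u \<noteq> v \<Longrightarrow> c {u, v} = Blue"
      by (rule coloured_copy_complete_graphE) blast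
    have red_degree: "s + 1 \<le> card {a \<in> A. c {x, a} = Red}" if x: "x \<in> {..<m} - A" for x
    proof -
      have "\<not> n - s \<le> card {a \<in> A. c {x, a} = Blue}"
      proof
        assume "n - s \<le> card {a \<in> A. c {x, a} = Blue}"
        then have "coloured_copy (insert x A) c Blue ?H"
          using coloured_copy_complete_minus_star[of A n c Blue, OF A(2,3) blue] x \<open>s \<le> n\<close> by blast
        then show False
          using no_blue coloured_copy_mono x A(1) by (metis DiffD1 insert_subset)
      qed
      moreover have "{a \<in> A. c {x, a} = Blue} = A - {a \<in> A. c {x, a} = Red}"
        using not_Red by auto
      then have "card {a \<in> A. c {x, a} = Blue} = n - card {a \<in> A. c {x, a} = Red}"
        using A(2,3) by (simp add: card_Diff_subset)
      ultimately show ?thesis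
        by linarith
    qed
    have "A \<noteq> {}"
      using A(3) \<open>1 \<le> n\<close> by auto
    then have "\<exists>a\<in>A. (s + 1) * card ({..<m} - A)
        \<le> card A * card {x \<in> {..<m} - A. c {x, a} = Red}"
      using A(2) red_degree by (intro exists_large_degree) simp_all
    then obtain a where a: "a \<in> A"
      and le: "(s + 1) * card ({..<m} - A) \<le> card A * card {x \<in> {..<m} - A. c {x, a} = Red}"
      by blast
    define U where "U = {x \<in> {..<m} - A. c {x, a} = Red}"
    have "card ({..<m} - A) = m - n"
      using A by (simp add: card_Diff_subset)
    then have "(s + 1) * (m - n) \<le> n * card U"
      using le unfolding U_def A(3) by simp
    \<comment> \<open>This turns the truncated difference \<open>m - n\<close> into a real
      one.\<close>
    moreover have "n \<le> m"
      using A card_mono[OF _ A(1)] by simp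
    ultimately have deg: "(real s + 1) * (real m - real n) \<le> real n * real (card U)"
      by (metis of_nat_1 of_nat_add of_nat_diff of_nat_le_iff of_nat_mult)
    have "(real s + 1) * (real_of_int N - real n) \<le> (real s + 1) * (real m - real n)"
      using \<open>nat N \<le> m\<close> by (intro mult_left_mono) linarith+
    then have "(real s + 1) * (real_of_int N - real n) \<le> real (card U) * real n"
      using deg by (simp only: mult.commute[of "real (card U)"])
    then have "(real s + 1) * (real_of_int N - real n) / real n \<le> real (card U)"
      using \<open>1 \<le> n\<close> by (simp only: divide_le_eq) simp
    \<comment> \<open>As \<open>card U\<close> is an integer, it also bounds the ceiling of the
      quotient.\<close>
    then have "ramsey_number G1 ?H \<le> card U"
      using assms(6) by linarith
    moreover have "finite U"
      by (simp add: U_def)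
    ultimately consider "coloured_copy U c Red G1" | "coloured_copy U c Blue ?H"
      using ramsey_number_coloured_copy[OF graphs(1,4)] by blast
    then show False
    proof cases
      case 1
      \<comment> \<open>The vertex \<open>a\<close> is new, since \<open>U\<close> lies outside
        \<open>A\<close>, and it is joined in red to all of \<open>U\<close>.\<close>
      have "coloured_copy (insert a U) c Red ?Gv"
        using 1 a by (intro coloured_copy_add_universal_vertex)
          (auto simp: U_def insert_commute[of _ a])
      moreover have "insert a U \<subseteq> {..<m}"
        using a A(1) by (auto simp: U_def)
      ultimately show False
        using no_red coloured_copy_mono by blast
    next
      case 2
      moreover have "U \<subseteq> {..<m}"
        by (auto simp: U_def)
      ultimately show False
        using no_blue coloured_copy_mono by blast
    qed
  qed
  then have "ramsey_number ?Gv ?H \<le> nat N"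
    by (intro ramsey_number_le graphs)
  then show ?thesis
    using assms(5) by linarith
qed

end
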